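(* For all positive integers $b,k,h$, the number $p_c(b,k,h)$ of corner-polyominoes inscribed in the $b\times k\times h$ prism satisfies $$p_c(b,k,h)=4\binom{b+h-2}{h-1}\binom{b+k+h-3}{b+h-2}+\sum_{i=0}^{h-2}(-1)^i\binom{b+h-4-2i}{h-2-i}\binom{b+k+h-4-i}{b+h-3-2i}$$ $$-2\left[\binom{b+h-2}{b-1}+\binom{b+k-2}{k-1}+\binom{k+h-2}{h-1}\right]+3-\frac{1+(-1)^h}{2}.$$
   Context: Cells are unit cubes indexed by integer triples $(i,j,l)$; two cells are adjacent if they share a face (differ by $1$ in exactly one coordinate). A polyomino is a finite nonempty face-connected set of cells. A polyomino is inscribed in the $b\times k\times h$ prism if all its cells lie in $[1,b]\times[1,k]\times[1,h]$ and it contains cells attaining each of the values $i=1$, $i=b$, $j=1$, $j=k$, $l=1$, $l=h$. Minimal inscribed polyominoes are those with the minimal possible number of cells, namely $b+k+h-2$. A corner-polyomino is a minimal inscribed polyomino containing the corner cell $(1,1,1)$. Binomial coefficients $\binom{n}{m}$ with integer $n$ (possibly negative) are understood as $n(n-1)\cdots(n-m+1)/m!$ for $m\ge 0$ (so $\binom{n}{0}=1$ for all $n$) and as $0$ for $m<0$; the sum is empty when $h=1$. *)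

theory Defs
  imports Complex_Main
begin

type_synonym cell = "int \<times> int \<times> int"

definition adjacent :: "cell \<Rightarrow> cell \<Rightarrow> bool" where
  "adjacent = (\<lambda>(i, j, l) (i', j', l').
     (\<bar>i - i'\<bar> = 1 \<and> j = j' \<and> l = l') \<or>
     (i = i' \<and> \<bar>j - j'\<bar> = 1 \<and> l = l') \<or>
     (i = i' \<and> j = j' \<and> \<bar>l - l'\<bar> = 1))"

definition face_connected :: "cell set \<Rightarrow> bool" where
  "face_connected P \<longleftrightarrow>
     (\<forall>c\<in>P. \<forall>d\<in>P. (c, d) \<in> {(x, y). x \<in> P \<and> y \<in> P \<and> adjacent x y}\<^sup>*)"

definition polyomino :: "cell set \<Rightarrow> bool" where
  "polyomino P \<longleftrightarrow> finite P \<and> P \<noteq> {} \<and> face_connected P"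

definition inscribed :: "nat \<Rightarrow> nat \<Rightarrow> nat \<Rightarrow> cell set \<Rightarrow> bool" where
  "inscribed b k h P \<longleftrightarrow>
     P \<subseteq> {1..int b} \<times> {1..int k} \<times> {1..int h} \<and>
     (\<exists>(i, j, l)\<in>P. i = 1) \<and> (\<exists>(i, j, l)\<in>P. i = int b) \<and>
     (\<exists>(i, j, l)\<in>P. j = 1) \<and> (\<exists>(i, j, l)\<in>P. j = int k) \<and>
     (\<exists>(i, j, l)\<in>P. l = 1) \<and> (\<exists>(i, j, l)\<in>P. l = int h)"

text \<open>For positive \<open>b\<close>, \<open>k\<close>, \<open>h\<close> the minimal number of cells is \<open>b + k + h - 2\<close>;
  the definition does not presuppose this value.\<close>

definition minimal_inscribed_polyomino :: "nat \<Rightarrow> nat \<Rightarrow> nat \<Rightarrow> cell set \<Rightarrow> bool" where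
  "minimal_inscribed_polyomino b k h P \<longleftrightarrow>
     is_arg_min card (\<lambda>Q. polyomino Q \<and> inscribed b k h Q) P"

definition corner_polyomino :: "nat \<Rightarrow> nat \<Rightarrow> nat \<Rightarrow> cell set \<Rightarrow> bool" where
  "corner_polyomino b k h P \<longleftrightarrow> minimal_inscribed_polyomino b k h P \<and> (1, 1, 1) \<in> P"

text \<open>The set counted here is finite, since its members are subsets of a finite box.\<close>

definition p_c :: "nat \<Rightarrow> nat \<Rightarrow> nat \<Rightarrow> nat" where
  "p_c b k h = card {P. corner_polyomino b k h P}"

text \<open>The upper index may be negative; by \<open>gchoose\<close> the value is then
  \<open>n (n - 1) \<dots> (n - m + 1) / m!\<close>. It vanishes for negative \<open>m\<close>, which \<open>nat\<close> alone
  would turn into \<open>1\<close>.\<close>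

definition binom :: "int \<Rightarrow> int \<Rightarrow> real" where
  "binom n m = (if m < 0 then 0 else real_of_int n gchoose nat m)"

end

theory Submission
  imports Defs
begin

text \<open>
  Grow a polyomino cell by cell. Each new cell enlarges the bounding box by at most one unit in
  one direction, so minimality forces every step to enlarge it. Starting from the corner
  \<open>(1, 1, 1)\<close>, this means that every step goes in a positive direction and that no two branches
  use the same direction: a corner polyomino is a rooted tree all of whose branchings split
  the set of directions. Decomposing at the root gives, at positive \<open>a, b, c\<close> (the side lengths
  minus one), the recurrence
  \<open>T(a, b, c) = T(a-1, b, c) + T(a, b-1, c) + T(a, b, c-1) + P(a, b) + P(a, c) + P(b, c) - 2\<close>,
  where \<open>P(a, b) = T(a, b, 0) = 2 ((a + b) choose a) - 1\<close>. The closed formula satisfies this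
  recurrence, its alternating sum even term by term, because Pascal's rule holds for
  \<open>binom\<close> at all integer arguments.
\<close>

section \<open>Axes and steps\<close>

datatype axis = AI | AJ | AL

fun coord :: "cell \<Rightarrow> axis \<Rightarrow> int" where
  "coord (i, j, l) AI = i"
| "coord (i, j, l) AJ = j"
| "coord (i, j, l) AL = l"

fun step :: "cell \<Rightarrow> axis \<Rightarrow> cell" where
  "step (i, j, l) AI = (i + 1, j, l)"
| "step (i, j, l) AJ = (i, j + 1, l)"
| "step (i, j, l) AL = (i, j, l + 1)"

lemma UNIV_axis: "(UNIV :: axis set) = {AI, AJ, AL}"
  using axis.exhaust by auto

lemma finite_axis [simp, intro]: "finite (A :: axis set)"
  by (rule finite_subset[of _ "{AI, AJ, AL}"]) (auto intro: axis.exhaust)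

lemma all_axis: "(\<forall>x. Q x) \<longleftrightarrow> Q AI \<and> Q AJ \<and> Q AL"
  by (metis axis.exhaust)

lemma ex_axis: "(\<exists>x. Q x) \<longleftrightarrow> Q AI \<or> Q AJ \<or> Q AL"
  by (metis axis.exhaust)

lemma coord_step [simp]: "coord (step c d) x = coord c x + (if x = d then 1 else 0)"
  by (cases c; cases d; cases x) auto

lemma cell_eqI: "(\<And>x. coord c x = coord d x) \<Longrightarrow> c = d"
  by (cases c; cases d) (metis coord.simps)

lemma step_neq [simp]: "step r d \<noteq> r" "r \<noteq> step r d"
  by (cases r; cases d; simp)+

lemma adjacent_iff: "adjacent c d \<longleftrightarrow> (\<exists>x. d = step c x \<or> c = step d x)"
proof -
  have *: "\<bar>a - a'\<bar> = 1 \<longleftrightarrow> a' = a + 1 \<or> a = a' + 1" for a a' :: int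
    by arith
  show ?thesis
    by (cases c; cases d) (auto simp: adjacent_def ex_axis *)
qed

lemma adjacent_sym: "adjacent c d \<Longrightarrow> adjacent d c"
  by (auto simp: adjacent_iff)

text \<open>Total extent of a box beyond its lowest corner; a tree with these extents has one cell
  more than this.\<close>

definition weight :: "(axis \<Rightarrow> nat) \<Rightarrow> nat" where
  "weight v = (\<Sum>x\<in>UNIV. v x)"

lemma weight_eq: "weight v = v AI + v AJ + v AL"
  by (simp add: weight_def UNIV_axis)

lemma weight_upd: "weight (v(d := n)) + v d = weight v + n"
  by (cases d) (auto simp: weight_eq)

section \<open>Connected sets\<close>

text \<open>An inductive form of connectedness with a marked starting cell; it supplies the
  cell-by-cell induction behind \<open>grown_box_bound\<close> and
  \<open>grown_tree\<close>.\<close>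

inductive grown :: "cell \<Rightarrow> cell set \<Rightarrow> bool" for r where
  root: "grown r {r}"
| insert: "grown r Q \<Longrightarrow> q \<in> Q \<Longrightarrow> adjacent q p \<Longrightarrow> p \<notin> Q \<Longrightarrow> grown r (insert p Q)"

lemma grown_finite: "grown r Q \<Longrightarrow> finite Q"
  by (induction rule: grown.induct) auto

lemma grown_root: "grown r Q \<Longrightarrow> r \<in> Q"
  by (induction rule: grown.induct) auto

lemma rtrancl_leaves_set:
  assumes "(a, b) \<in> E\<^sup>*" "a \<in> Q" "b \<notin> Q"
  shows "\<exists>x y. (x, y) \<in> E \<and> x \<in> Q \<and> y \<notin> Q"
  using assms by (induction rule: rtrancl_induct) auto

text \<open>A maximal grown subset of \<open>P\<close> must be all of \<open>P\<close>: a path in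
  \<open>P\<close> from \<open>r\<close> to a missing cell would leave it somewhere, and that edge
  allows one more insertion.\<close>

lemma face_connected_grown:
  assumes "finite P" "face_connected P" "r \<in> P"
  shows "grown r P"
proof -
  define F where "F = {Q. grown r Q \<and> Q \<subseteq> P}"
  have "finite F" using assms(1) by (auto simp: F_def intro: finite_subset[of _ "Pow P"])
  moreover have "{r} \<in> F" using assms(3) by (auto simp: F_def intro: grown.root)
  ultimately obtain Q where Q: "Q \<in> F" "\<And>R. R \<in> F \<Longrightarrow> Q \<subseteq> R \<Longrightarrow> Q = R"
    using finite_has_maximal[of F] by blast
  have "Q = P"
  proof (rule ccontr)
    assume "Q \<noteq> P"
    then obtain p where p: "p \<in> P" "p \<notin> Q" using Q(1) by (auto simp: F_def)
    have "r \<in> Q" using Q(1) grown_root by (auto simp: F_def)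
    with rtrancl_leaves_set[of r p "{(x, y). x \<in> P \<and> y \<in> P \<and> adjacent x y}" Q] assms(2,3) p
    obtain x y where "adjacent x y" "x \<in> Q" "y \<in> P" "y \<notin> Q"
      by (auto simp: face_connected_def)
    then have "insert y Q \<in> F" using Q(1) by (auto simp: F_def intro: grown.insert)
    with Q(2) \<open>y \<notin> Q\<close> show False by blast
  qed
  then show ?thesis using Q(1) by (auto simp: F_def)
qed

lemma grown_face_connected: "grown r Q \<Longrightarrow> face_connected Q"
proof (induction rule: grown.induct)
  case root
  then show ?case by (auto simp: face_connected_def)
next
  case (insert Q q p)
  define E where "E = (\<lambda>A. {(x, y). x \<in> A \<and> y \<in> A \<and> adjacent x y})"
  have mono: "(E Q)\<^sup>* \<subseteq> (E (insert p Q))\<^sup>*"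
    by (intro rtrancl_mono) (auto simp: E_def)
  have Q: "(c, d) \<in> (E (insert p Q))\<^sup>*" if "c \<in> Q" "d \<in> Q" for c d
  proof -
    have "(c, d) \<in> (E Q)\<^sup>*"
      unfolding E_def by (rule insert.IH[unfolded face_connected_def, rule_format, OF that])
    then show ?thesis using mono by (rule rev_subsetD)
  qed
  have e: "(q, p) \<in> E (insert p Q)" "(p, q) \<in> E (insert p Q)"
    using insert.hyps by (auto simp: E_def intro: adjacent_sym)
  have "(c, q) \<in> (E (insert p Q))\<^sup>*" "(q, c) \<in> (E (insert p Q))\<^sup>*" if "c \<in> insert p Q" for c
    using that Q[OF _ insert.hyps(2), of c] Q[OF insert.hyps(2), of c] e by (auto intro: r_into_rtrancl)
  then have "(c, d) \<in> (E (insert p Q))\<^sup>*" if "c \<in> insert p Q" "d \<in> insert p Q" for c d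
    using that by (meson rtrancl_trans)
  then show ?case
    by (simp only: face_connected_def E_def) simp
qed

lemma grown_Un: "grown r Q \<Longrightarrow> grown r R \<Longrightarrow> grown r (Q \<union> R)"
proof (induction rule: grown.induct)
  case root
  then show ?case using grown_root by (auto simp: insert_absorb)
next
  case (insert Q q p)
  show ?case
  proof (cases "p \<in> R")
    case True
    then show ?thesis using insert by (auto simp: insert_absorb)
  next
    case False
    then show ?thesis using insert grown.insert[of r "Q \<union> R" q p] by auto
  qed
qed

text \<open>Replay the growth of \<open>Q\<close> after attaching \<open>s\<close> to
  \<open>r\<close>; should \<open>r\<close> itself come up as a new cell, that insertion is
  skipped.\<close>

lemma grown_shift: "grown s Q \<Longrightarrow> adjacent r s \<Longrightarrow> grown r (insert r Q)"
proof (induction rule: grown.induct)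
  case root
  then show ?case
    using grown.insert[OF grown.root[of r], of r s]
    by (cases "s = r") (auto simp: insert_commute grown.root)
next
  case (insert Q q p)
  show ?case
  proof (cases "p = r")
    case True
    then show ?thesis using insert by auto
  next
    case False
    then show ?thesis using insert grown.insert[of r "insert r Q" q p]
      by (auto simp: insert_commute)
  qed
qed

text \<open>A new cell is next to an old one, so it leaves the box by at most one unit along one
  axis. The bounds need not be tight; this suffices for \<open>inscribed_card\<close>.\<close>

lemma grown_box_bound:
  assumes "grown r P"
  shows "\<exists>lo hi. (\<forall>p\<in>P. \<forall>x. lo x \<le> coord p x \<and> coord p x \<le> hi x) \<and>
    (\<Sum>x\<in>UNIV. hi x - lo x) + 1 \<le> int (card P)"
  using assms
proof (induction rule: grown.induct)
  case root
  then show ?case by (intro exI[of _ "coord r"]) auto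
next
  case (insert Q q p)
  then obtain lo hi where box: "\<And>p x. p \<in> Q \<Longrightarrow> lo x \<le> coord p x \<and> coord p x \<le> hi x"
    and c: "(\<Sum>x\<in>UNIV. hi x - lo x) + 1 \<le> int (card Q)"
    by blast
  have card: "card (insert p Q) = Suc (card Q)"
    using insert grown_finite by auto
  obtain d where "p = step q d \<or> q = step p d"
    using insert by (auto simp: adjacent_iff)
  then show ?case
  proof
    assume p: "p = step q d"
    have *: "coord p x = coord q x + (if x = d then 1 else 0)" for x by (simp add: p)
    show ?thesis
    proof (intro exI conjI)
      show "\<forall>c\<in>insert p Q. \<forall>x. lo x \<le> coord c x \<and> coord c x \<le> (hi(d := hi d + 1)) x"
      proof (intro ballI allI)
        fix c x
        assume "c \<in> insert p Q"
        then show "lo x \<le> coord c x \<and> coord c x \<le> (hi(d := hi d + 1)) x"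
          using box[of c x] box[OF insert.hyps(2), of x] * by auto
      qed
      show "(\<Sum>x\<in>UNIV. (hi(d := hi d + 1)) x - lo x) + 1 \<le> int (card (insert p Q))"
        using c card by (cases d) (auto simp: UNIV_axis)
    qed
  next
    assume q: "q = step p d"
    have *: "coord p x = coord q x - (if x = d then 1 else 0)" for x by (simp add: q)
    show ?thesis
    proof (intro exI conjI)
      show "\<forall>c\<in>insert p Q. \<forall>x. (lo(d := lo d - 1)) x \<le> coord c x \<and> coord c x \<le> hi x"
      proof (intro ballI allI)
        fix c x
        assume "c \<in> insert p Q"
        then show "(lo(d := lo d - 1)) x \<le> coord c x \<and> coord c x \<le> hi x"
          using box[of c x] box[OF insert.hyps(2), of x] * by auto
      qed
      show "(\<Sum>x\<in>UNIV. hi x - (lo(d := lo d - 1)) x) + 1 \<le> int (card (insert p Q))"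
        using c card by (cases d) (auto simp: UNIV_axis)
    qed
  qed
qed

section \<open>Trees with disjoint branches\<close>

text \<open>In \<open>tree r v P\<close>, the box spanned by \<open>P\<close> has lowest corner \<open>r\<close> and extends \<open>v x\<close> cells
  beyond it along each axis \<open>x\<close>.\<close>

inductive tree :: "cell \<Rightarrow> (axis \<Rightarrow> nat) \<Rightarrow> cell set \<Rightarrow> bool" where
  leaf: "tree r (\<lambda>_. 0) {r}"
| shift: "tree (step r d) v Q \<Longrightarrow> tree r (v(d := Suc (v d))) (insert r Q)"
| join: "tree r v Q \<Longrightarrow> tree r w R \<Longrightarrow> (\<And>x. v x = 0 \<or> w x = 0) \<Longrightarrow>
    tree r (\<lambda>x. v x + w x) (Q \<union> R)"

lemma tree_grown: "tree r v P \<Longrightarrow> grown r P"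
  by (induction rule: tree.induct) (blast intro: grown.root grown_shift grown_Un adjacent_iff[THEN iffD2])+

lemmas tree_root = grown_root[OF tree_grown] and tree_finite = grown_finite[OF tree_grown]

lemma tree_box:
  "tree r v P \<Longrightarrow> p \<in> P \<Longrightarrow> coord r x \<le> coord p x \<and> coord p x \<le> coord r x + int (v x)"
proof (induction arbitrary: p x rule: tree.induct)
  case (shift r d v Q)
  show ?case
  proof (cases "p = r")
    case False
    then show ?thesis using shift.IH[of p x] shift.prems by (auto split: if_splits)
  qed auto
next
  case (join r v Q w R)
  from join.prems(1) show ?case
  proof
    assume "p \<in> Q"
    then show ?thesis using join.IH(1)[of p x] by simp
  next
    assume "p \<in> R"
    then show ?thesis using join.IH(2)[of p x] by simp
  qed
qed auto

lemma root_notin_child: "tree (step r d) v Q \<Longrightarrow> r \<notin> Q"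
  using tree_box[of "step r d" v Q r d] by auto

text \<open>In a join one branch has no extent along \<open>x\<close>, so the maximum of the other
  is the one wanted.\<close>

lemma tree_max: "tree r v P \<Longrightarrow> \<exists>p\<in>P. coord p x = coord r x + int (v x)"
proof (induction rule: tree.induct)
  case (shift r d v Q)
  then obtain p where "p \<in> Q" "coord p x = coord (step r d) x + int (v x)" by blast
  then show ?case by (intro bexI[of _ p]) auto
next
  case (join r v Q w R)
  then obtain p q where "p \<in> Q" "coord p x = coord r x + int (v x)"
    "q \<in> R" "coord q x = coord r x + int (w x)" by blast
  then show ?case using join.hyps(3)[of x] by (metis UnI1 UnI2 add_0 add_0_right)
qed auto

lemma tree_card: "tree r v P \<Longrightarrow> card P = Suc (weight v)"
proof (induction rule: tree.induct)
  case (leaf r)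
  then show ?case by (simp add: weight_def)
next
  case (shift r d v Q)
  have "r \<notin> Q" using shift.hyps by (rule root_notin_child)
  then show ?case using shift tree_finite[OF shift.hyps] weight_upd[of v d "Suc (v d)"]
    by (simp del: fun_upd_apply)
next
  case (join r v Q w R)
  \<comment> \<open>Along each axis one of the two branches does not extend, so a common cell agrees
    with \<open>r\<close> in every coordinate.\<close>
  have "Q \<inter> R = {r}"
  proof -
    have "p = r" if "p \<in> Q" "p \<in> R" for p
    proof (rule cell_eqI)
      fix x
      show "coord p x = coord r x"
        using tree_box[OF join.hyps(1) that(1), of x] tree_box[OF join.hyps(2) that(2), of x]
          join.hyps(3)[of x] by auto
    qed
    then show ?thesis using tree_root join.hyps by auto
  qed
  then have "card Q + card R = card (Q \<union> R) + 1"
    using card_Un_Int[of Q R] tree_finite join.hyps by auto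
  then show ?case using join.IH by (simp add: weight_eq)
qed

text \<open>The construction is a monotone path. Its role is to show that the lower bound on the
  size is attained.\<close>

lemma tree_exists: "\<exists>P. tree r v P"
proof (induction "weight v" arbitrary: r v)
  case 0
  then have "v = (\<lambda>_. 0)" by (simp add: weight_eq fun_eq_iff all_axis)
  then show ?case using leaf by blast
next
  case (Suc n)
  then obtain d where d: "v d > 0" 
    by (metis Suc_neq_Zero add_is_0 gr0I weight_eq)
  define w where "w = v(d := v d - 1)"
  have "weight w = n" using weight_upd[of v d "v d - 1"] d Suc.hyps by (simp add: w_def)
  then obtain Q where "tree (step r d) w Q" using Suc.hyps(1) by blast
  from tree.shift[OF this] have "tree r v (insert r Q)" using d by (simp add: w_def)
  then show ?case by blast
qed

text \<open>Only a branch carrying the whole extent along \<open>d\<close> reaches the far face of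
  the box, so a step out of that face is made inside this branch. At a root with no extent along
  \<open>d\<close> the step opens a new branch, disjoint in direction from the old one.\<close>

lemma tree_extend:
  "tree r v P \<Longrightarrow> q \<in> P \<Longrightarrow> coord q d = coord r d + int (v d) \<Longrightarrow>
    tree r (v(d := Suc (v d))) (insert (step q d) P)"
proof (induction arbitrary: q rule: tree.induct)
  case (leaf r)
  then show ?case
    using tree.shift[OF tree.leaf[of "step r d"]] by (simp add: insert_commute del: fun_upd_apply)
next
  case (shift r e v Q)
  show ?case
  proof (cases "q = r")
    case True
    with shift.prems have d: "d \<noteq> e" "v d = 0" by (auto split: if_splits)
    have "tree r ((\<lambda>_. 0)(d := Suc 0)) {r, step r d}"
      using tree.shift[OF tree.leaf[of "step r d"]] by simp
    from tree.join[OF this tree.shift[OF shift.hyps]]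
    have "tree r (\<lambda>x. ((\<lambda>_. 0)(d := Suc 0)) x + (v(e := Suc (v e))) x) ({r, step r d} \<union> insert r Q)"
      using d by auto
    moreover have "(\<lambda>x. ((\<lambda>_. 0)(d := Suc 0)) x + (v(e := Suc (v e))) x)
        = (v(e := Suc (v e)))(d := Suc ((v(e := Suc (v e))) d))"
      using d by auto
    moreover have "{r, step r d} \<union> insert r Q = insert (step q d) (insert r Q)"
      using True by auto
    ultimately show ?thesis by (simp del: fun_upd_apply)
  next
    case False
    then have "q \<in> Q" using shift.prems by auto
    moreover have "coord q d = coord (step r e) d + int (v d)"
      using shift.prems by (auto split: if_splits)
    ultimately have "tree (step r e) (v(d := Suc (v d))) (insert (step q d) Q)"
      by (rule shift.IH)
    from tree.shift[OF this]
    have "tree r ((v(d := Suc (v d)))(e := Suc ((v(d := Suc (v d))) e))) (insert r (insert (step q d) Q))" .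
    moreover have "(v(d := Suc (v d)))(e := Suc ((v(d := Suc (v d))) e))
        = (v(e := Suc (v e)))(d := Suc ((v(e := Suc (v e))) d))"
      by auto
    ultimately show ?thesis by (simp add: insert_commute del: fun_upd_apply)
  qed
next
  case (join r v Q w R)
  show ?case
  proof (cases "q \<in> Q")
    case True
    then have w: "w d = 0"
      using tree_box[OF join.hyps(1) True, of d] join.prems join.hyps(3)[of d] by auto
    then have "tree r (v(d := Suc (v d))) (insert (step q d) Q)"
      using join.IH(1)[OF True] join.prems w by (simp del: fun_upd_apply)
    moreover have "(v(d := Suc (v d))) x = 0 \<or> w x = 0" for x
      using join.hyps(3)[of x] w by simp
    ultimately have "tree r (\<lambda>x. (v(d := Suc (v d))) x + w x) (insert (step q d) Q \<union> R)"
      using tree.join[OF _ join.hyps(2)] by blast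
    moreover have "(\<lambda>x. (v(d := Suc (v d))) x + w x)
        = (\<lambda>x. v x + w x)(d := Suc (v d + w d))"
      by auto
    ultimately show ?thesis by (simp del: fun_upd_apply)
  next
    case False
    then have q: "q \<in> R" using join.prems by auto
    then have v: "v d = 0"
      using tree_box[OF join.hyps(2) q, of d] join.prems join.hyps(3)[of d] by auto
    then have "tree r (w(d := Suc (w d))) (insert (step q d) R)"
      using join.IH(2)[OF q] join.prems v by (simp del: fun_upd_apply)
    moreover have "v x = 0 \<or> (w(d := Suc (w d))) x = 0" for x
      using join.hyps(3)[of x] v by simp
    ultimately have "tree r (\<lambda>x. v x + (w(d := Suc (w d))) x) (Q \<union> insert (step q d) R)"
      using tree.join[OF join.hyps(1)] by blast
    moreover have "(\<lambda>x. v x + (w(d := Suc (w d))) x)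
        = (\<lambda>x. v x + w x)(d := Suc (v d + w d))"
      by auto
    ultimately show ?thesis by (simp del: fun_upd_apply)
  qed
qed

text \<open>A cell inside the current box costs one cell without enlarging it, and this excess is
  never regained; if it never occurs, \<open>tree_extend\<close> applies at every step. The lower
  bound on the coordinates lets the box grow only away from \<open>r\<close>.\<close>

lemma grown_tree:
  assumes "grown r P" "\<And>p x. p \<in> P \<Longrightarrow> coord r x \<le> coord p x"
  shows "\<exists>v. (\<forall>p\<in>P. \<forall>x. coord p x \<le> coord r x + int (v x)) \<and>
    (weight v + 2 \<le> card P \<or> tree r v P)"
  using assms
proof (induction rule: grown.induct)
  case root
  then show ?case using leaf by (intro exI[of _ "\<lambda>_. 0"]) auto
next
  case (insert Q q p)
  then obtain v where box: "\<And>p x. p \<in> Q \<Longrightarrow> coord p x \<le> coord r x + int (v x)"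
    and c: "weight v + 2 \<le> card Q \<or> tree r v Q"
    by blast
  have card: "card (insert p Q) = Suc (card Q)"
    using insert grown_finite by auto
  show ?case
  proof (cases "\<forall>x. coord p x \<le> coord r x + int (v x)")
    case True
    moreover have "weight v + 2 \<le> card (insert p Q)" using c card tree_card[of r v Q] by linarith
    ultimately show ?thesis using box by (intro exI[of _ v]) blast
  next
    case False
    then obtain d where d: "coord p d > coord r d + int (v d)" by (auto simp: not_le)
    obtain e where "p = step q e \<or> q = step p e"
      using insert by (auto simp: adjacent_iff)
    \<comment> \<open>The step cannot be \<open>q = step p e\<close>: as \<open>q\<close> is inside
      the box, \<open>p\<close> would then be inside it along \<open>d\<close> as well.\<close>
    with d box[OF insert.hyps(2), of d] have p: "p = step q d"
      and q: "coord q d = coord r d + int (v d)" by (auto split: if_splits)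
    have "weight (v(d := Suc (v d))) = Suc (weight v)" using weight_upd[of v d "Suc (v d)"] by simp
    moreover have "coord c x \<le> coord r x + int ((v(d := Suc (v d))) x)" if "c \<in> insert p Q" for c x
      using that box[of c x] box[of q x] q insert.hyps(2) by (auto simp: p)
    ultimately show ?thesis
      using c card tree_extend[of r v Q q d] q p insert.hyps(2)
      by (intro exI[of _ "v(d := Suc (v d))"]) (auto simp del: fun_upd_apply)
  qed
qed

section \<open>Corner polyominoes are trees\<close>

text \<open>Used both for side lengths and for extents, which are one smaller.\<close>

definition dims :: "nat \<Rightarrow> nat \<Rightarrow> nat \<Rightarrow> axis \<Rightarrow> nat" where
  "dims a b c x = (case x of AI \<Rightarrow> a | AJ \<Rightarrow> b | AL \<Rightarrow> c)"

lemma dims_simps [simp]: "dims a b c AI = a" "dims a b c AJ = b" "dims a b c AL = c"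
  by (simp_all add: dims_def)

lemma dims_eqI: "v AI = a \<Longrightarrow> v AJ = b \<Longrightarrow> v AL = c \<Longrightarrow> v = dims a b c"
  by (simp add: fun_eq_iff all_axis)

lemma weight_dims [simp]: "weight (dims a b c) = a + b + c"
  by (simp add: weight_eq)

lemma coord_one [simp]: "coord (1, 1, 1) x = 1"
  by (cases x) auto

lemma inscribed_iff:
  "inscribed b k h P \<longleftrightarrow>
    (\<forall>p\<in>P. \<forall>x. 1 \<le> coord p x \<and> coord p x \<le> int (dims b k h x)) \<and>
    (\<forall>x. (\<exists>p\<in>P. coord p x = 1) \<and> (\<exists>p\<in>P. coord p x = int (dims b k h x)))"
  unfolding inscribed_def all_axis
  by (auto simp: subset_iff; force)

lemma inscribed_card:
  assumes "polyomino P" "inscribed b k h P"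
  shows "b + k + h \<le> card P + 2"
proof -
  obtain r where "r \<in> P" using assms(1) by (auto simp: polyomino_def)
  then have "grown r P" using assms(1) face_connected_grown by (auto simp: polyomino_def)
  from grown_box_bound[OF this] obtain lo hi
    where box: "\<And>p x. p \<in> P \<Longrightarrow> lo x \<le> coord p x \<and> coord p x \<le> hi x"
      and c: "(\<Sum>x\<in>UNIV. hi x - lo x) + 1 \<le> int (card P)" by blast
  have "int (dims b k h x) - 1 \<le> hi x - lo x" for x
  proof -
    from assms(2) obtain p q where "p \<in> P" "coord p x = 1" "q \<in> P" "coord q x = int (dims b k h x)"
      unfolding inscribed_iff by blast
    then show ?thesis using box[of p x] box[of q x] by simp
  qed
  from this[of AI] this[of AJ] this[of AL] c show ?thesis
    by (simp add: UNIV_axis)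
qed

lemma tree_inscribed:
  assumes "tree (1, 1, 1) (dims (b - 1) (k - 1) (h - 1)) P" "b \<ge> 1" "k \<ge> 1" "h \<ge> 1"
  shows "polyomino P" "inscribed b k h P" "card P + 2 = b + k + h"
proof -
  show "polyomino P"
    using tree_root[OF assms(1)] tree_finite[OF assms(1)] grown_face_connected[OF tree_grown[OF assms(1)]]
    by (auto simp: polyomino_def)
  have d: "int (dims b k h x) = 1 + int (dims (b - 1) (k - 1) (h - 1) x)" for x
    using assms by (cases x) auto
  show "inscribed b k h P"
    unfolding inscribed_iff d
  proof (intro conjI ballI allI)
    fix p x assume "p \<in> P"
    from tree_box[OF assms(1) this, of x]
    show "1 \<le> coord p x" "coord p x \<le> 1 + int (dims (b - 1) (k - 1) (h - 1) x)" by simp_all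
  next
    fix x
    show "\<exists>p\<in>P. coord p x = 1" using tree_root[OF assms(1)] by (intro bexI[of _ "(1, 1, 1)"]) simp_all
    show "\<exists>p\<in>P. coord p x = 1 + int (dims (b - 1) (k - 1) (h - 1) x)"
      using tree_max[OF assms(1), of x] by simp
  qed
  show "card P + 2 = b + k + h" using tree_card[OF assms(1)] assms by simp
qed

text \<open>Trees attain the lower bound of \<open>inscribed_card\<close>. Conversely, their
  existence caps the size of a minimal polyomino, which rules out the excess alternative of
  \<open>grown_tree\<close>.\<close>

lemma corner_polyomino_iff:
  assumes "b \<ge> 1" "k \<ge> 1" "h \<ge> 1"
  shows "corner_polyomino b k h P \<longleftrightarrow> tree (1, 1, 1) (dims (b - 1) (k - 1) (h - 1)) P"
proof
  assume P: "tree (1, 1, 1) (dims (b - 1) (k - 1) (h - 1)) P"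
  from tree_inscribed[OF P assms] inscribed_card[of _ b k h] tree_root[OF P]
  show "corner_polyomino b k h P"
    by (fastforce simp: corner_polyomino_def minimal_inscribed_polyomino_def is_arg_min_def not_less)
next
  assume "corner_polyomino b k h P"
  then have P: "polyomino P" "inscribed b k h P" "(1, 1, 1) \<in> P"
    and min: "\<And>Q. polyomino Q \<Longrightarrow> inscribed b k h Q \<Longrightarrow> card P \<le> card Q"
    by (auto simp: corner_polyomino_def minimal_inscribed_polyomino_def is_arg_min_def not_less)
  obtain Q where "tree (1, 1, 1) (dims (b - 1) (k - 1) (h - 1)) Q" using tree_exists by blast
  from tree_inscribed[OF this assms] min have c: "card P + 2 \<le> b + k + h" by fastforce
  have "grown (1, 1, 1) P" using P face_connected_grown by (auto simp: polyomino_def)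
  moreover have "coord (1, 1, 1) x \<le> coord p x" if "p \<in> P" for p x
    using P(2) that unfolding inscribed_iff by simp
  ultimately obtain v where box: "\<And>p x. p \<in> P \<Longrightarrow> coord p x \<le> 1 + int (v x)"
    and v: "weight v + 2 \<le> card P \<or> tree (1, 1, 1) v P"
    using grown_tree[of "(1, 1, 1)" P] unfolding coord_one by blast
  have le: "dims b k h x \<le> 1 + v x" for x
  proof -
    from P(2) obtain p where "p \<in> P" "coord p x = int (dims b k h x)"
      unfolding inscribed_iff by blast
    then show ?thesis using box[of p x] by simp
  qed
  have w: "b + k + h \<le> 3 + weight v"
    using le[of AI] le[of AJ] le[of AL] by (simp add: weight_eq)
  with c v have t: "tree (1, 1, 1) v P" by linarith
  \<comment> \<open>Each \<open>v x\<close> is at least the extent of the prism and the totals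
    agree, so there is equality on every axis.\<close>
  have "weight v + 3 = b + k + h" using w c tree_card[OF t] by linarith
  then have "v = dims (b - 1) (k - 1) (h - 1)"
    using le[of AI] le[of AJ] le[of AL] assms by (intro dims_eqI) (simp_all add: weight_eq)
  with t show "tree (1, 1, 1) (dims (b - 1) (k - 1) (h - 1)) P" by simp
qed

section \<open>Decomposition at the root\<close>

abbreviation trees :: "cell \<Rightarrow> (axis \<Rightarrow> nat) \<Rightarrow> cell set set" where
  "trees r v \<equiv> {P. tree r v P}"

text \<open>Both branches must be nontrivial: joining with the one-cell tree gives back the other
  tree, which would destroy the separation from trees whose root has a single child.\<close>

definition joins :: "cell \<Rightarrow> (axis \<Rightarrow> nat) \<Rightarrow> cell set set" where
  "joins r v = {Q \<union> R | u w Q R. tree r u Q \<and> tree r w R \<and> (\<forall>x. u x = 0 \<or> w x = 0) \<and>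
     (\<exists>x. u x > 0) \<and> (\<exists>x. w x > 0) \<and> v = (\<lambda>x. u x + w x)}"

lemma tree_zero: "tree r v P \<Longrightarrow> v = (\<lambda>_. 0) \<Longrightarrow> P = {r}"
  using tree_card[of r v P] tree_root[of r v P] by (auto simp: weight_def card_1_singleton_iff)

text \<open>A join with a one-cell branch is not a genuine splitting, so that case falls back on the
  induction hypothesis for the other branch.\<close>

lemma tree_cases_root:
  "tree r v P \<Longrightarrow> v = (\<lambda>_. 0) \<or> P \<in> joins r v \<or>
    (\<exists>d Q. v d > 0 \<and> tree (step r d) (v(d := v d - 1)) Q \<and> P = insert r Q)"
proof (induction rule: tree.induct)
  case (shift r d v Q)
  then have "(v(d := Suc (v d))) d > 0 \<and>
      tree (step r d) ((v(d := Suc (v d)))(d := (v(d := Suc (v d))) d - 1)) Q"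
    by simp
  then show ?case by blast
next
  case (join r v Q w R)
  consider "v = (\<lambda>_. 0)" | "w = (\<lambda>_. 0)" | "\<exists>x. v x > 0" "\<exists>x. w x > 0" by fastforce
  then show ?case
  proof cases
    case 1
    then have "Q \<union> R = R" using tree_zero[OF join.hyps(1)] tree_root[OF join.hyps(2)] by auto
    then show ?thesis using join.IH(2) 1 by simp
  next
    case 2
    then have "Q \<union> R = Q" using tree_zero[OF join.hyps(2)] tree_root[OF join.hyps(1)] by auto
    then show ?thesis using join.IH(1) 2 by simp
  next
    case 3
    then have "Q \<union> R \<in> joins r (\<lambda>x. v x + w x)"
      using join.hyps unfolding joins_def by blast
    then show ?thesis by blast
  qed
qed auto

lemma joins_subset: "joins r v \<subseteq> trees r v"
  unfolding joins_def using tree.join by blast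

lemma tree_has_child: "tree r v P \<Longrightarrow> v x > 0 \<Longrightarrow> \<exists>d. v d > 0 \<and> step r d \<in> P"
proof (induction arbitrary: x rule: tree.induct)
  case (shift r d v Q)
  then show ?case using tree_root[OF shift.hyps] by (intro exI[of _ d]) auto
next
  case (join r v Q w R)
  then show ?case by (metis UnI1 UnI2 add_gr_0)
qed auto

text \<open>Each nontrivial branch contains a neighbour of the root, and disjointness of directions
  makes the two differ. With \<open>shifted_child\<close> this separates joins from shifted
  trees.\<close>

lemma joins_children:
  assumes "P \<in> joins r v"
  shows "\<exists>d e. d \<noteq> e \<and> step r d \<in> P \<and> step r e \<in> P"
proof -
  from assms obtain u w Q R where *: "tree r u Q" "tree r w R" "\<And>x. u x = 0 \<or> w x = 0"
    "\<exists>x. u x > 0" "\<exists>x. w x > 0" "P = Q \<union> R"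
    unfolding joins_def by blast
  from *(1,4) obtain d where d: "u d > 0" "step r d \<in> Q" using tree_has_child by blast
  from *(2,5) obtain e where e: "w e > 0" "step r e \<in> R" using tree_has_child by blast
  from d e *(3)[of d] have "d \<noteq> e" by auto
  with d e *(6) show ?thesis by blast
qed

lemma trees_subset_Pow: "trees r v \<subseteq> Pow {p. \<forall>x. coord r x \<le> coord p x \<and> coord p x \<le> coord r x + int (v x)}"
  using tree_box by blast

lemma finite_trees: "finite (trees r v)"
proof -
  let ?I = "\<lambda>x. {coord r x..coord r x + int (v x)}"
  have "{p. \<forall>x. coord r x \<le> coord p x \<and> coord p x \<le> coord r x + int (v x)} \<subseteq> ?I AI \<times> ?I AJ \<times> ?I AL"
    by (auto simp: all_axis)
  from finite_subset[OF this] have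
    "finite {p. \<forall>x. coord r x \<le> coord p x \<and> coord p x \<le> coord r x + int (v x)}" by simp
  then show ?thesis using trees_subset_Pow finite_subset by (metis (lifting) finite_Pow_iff)
qed

text \<open>Everything in \<open>Q\<close> lies at least one unit beyond \<open>r\<close> along
  \<open>d\<close>, which fails for a neighbour of \<open>r\<close> in any other direction.\<close>

lemma shifted_child:
  assumes "tree (step r d) v Q" "step r e \<in> insert r Q"
  shows "e = d"
  using tree_box[OF assms(1), of "step r e" d] assms(2) by (auto split: if_splits)

lemma trees_decomp:
  assumes "v \<noteq> (\<lambda>_. 0)"
  shows "trees r v = (\<Union>d\<in>{d. v d > 0}. insert r ` trees (step r d) (v(d := v d - 1))) \<union> joins r v"
    (is "_ = ?U")
proof
  show "trees r v \<subseteq> ?U" using tree_cases_root[of r v] assms by blast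
  have "tree r v (insert r Q)" if "tree (step r d) (v(d := v d - 1)) Q" "v d > 0" for d Q
    using tree.shift[OF that(1)] that(2) by simp
  then show "?U \<subseteq> trees r v" using joins_subset by blast
qed

text \<open>The directions \<open>e\<close> with \<open>step r e\<close> in the tree reveal its
  class: exactly \<open>d\<close> for a shifted tree, at least two for a join. Removing the root
  inverts \<open>insert r\<close>, since \<open>r\<close> is not in the child tree.\<close>

lemma card_trees_decomp:
  assumes "v \<noteq> (\<lambda>_. 0)"
  shows "card (trees r v) = (\<Sum>d\<in>{d. v d > 0}. card (trees (step r d) (v(d := v d - 1)))) + card (joins r v)"
proof -
  let ?S = "\<lambda>d. insert r ` trees (step r d) (v(d := v d - 1))"
  have child: "step r e \<in> P \<longleftrightarrow> e = d" if P: "P \<in> ?S d" for P d e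
  proof -
    from P obtain Q where "tree (step r d) (v(d := v d - 1)) Q" "P = insert r Q" by blast
    then show ?thesis using shifted_child[of r d _ Q e] tree_root[of "step r d" _ Q] by blast
  qed
  have "P \<notin> joins r v" if "P \<in> ?S d" for P d
    using child[OF that] joins_children[of P r v] by auto
  then have "(\<Union>d\<in>{d. v d > 0}. ?S d) \<inter> joins r v = {}"
    by auto
  moreover have "finite (joins r v)" using finite_subset[OF joins_subset finite_trees] .
  ultimately have "card (trees r v) = card (\<Union>d\<in>{d. v d > 0}. ?S d) + card (joins r v)"
    unfolding trees_decomp[OF assms] using finite_trees by (intro card_Un_disjoint) auto
  moreover have "card (\<Union>d\<in>{d. v d > 0}. ?S d) = (\<Sum>d\<in>{d. v d > 0}. card (?S d))"
  proof (rule card_UN_disjoint)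
    have "?S d \<inter> ?S e = {}" if "d \<noteq> e" for d e
    proof -
      have "P \<notin> ?S e" if "P \<in> ?S d" for P
        using child[of P d d] child[of P e d] that \<open>d \<noteq> e\<close> by metis
      then show ?thesis by blast
    qed
    then show "\<forall>d\<in>{d. v d > 0}. \<forall>e\<in>{d. v d > 0}. d \<noteq> e \<longrightarrow> ?S d \<inter> ?S e = {}"
      by simp
  qed (simp_all add: finite_trees)
  moreover have "card (?S d) = card (trees (step r d) (v(d := v d - 1)))" for d
  proof (rule card_image, rule inj_onI)
    fix Q R
    assume Q: "Q \<in> trees (step r d) (v(d := v d - 1))" and R: "R \<in> trees (step r d) (v(d := v d - 1))"
      and eq: "insert r Q = insert r R"
    have "r \<notin> Q" "r \<notin> R"
      using Q R root_notin_child by blast+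
    with eq show "Q = R" by (metis insert_ident)
  qed
  ultimately show ?thesis by simp
qed

section \<open>Branches using a single direction\<close>

definition line :: "cell \<Rightarrow> axis \<Rightarrow> nat \<Rightarrow> cell set" where
  "line r d n = {p. (\<forall>x. x \<noteq> d \<longrightarrow> coord p x = coord r x) \<and>
     coord r d \<le> coord p d \<and> coord p d \<le> coord r d + int n}"

lemma card_line: "finite (line r d n)" "card (line r d n) \<le> Suc n"
proof -
  have inj: "inj_on (\<lambda>p. coord p d) (line r d n)"
  proof (rule inj_onI)
    fix p q assume *: "p \<in> line r d n" "q \<in> line r d n" "coord p d = coord q d"
    show "p = q"
    proof (rule cell_eqI)
      fix x show "coord p x = coord q x" using * by (cases "x = d") (simp_all add: line_def)
    qed
  qed
  have sub: "(\<lambda>p. coord p d) ` line r d n \<subseteq> {coord r d..coord r d + int n}"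
    by (auto simp: line_def)
  show "finite (line r d n)"
    using inj sub by (rule inj_on_finite) simp
  show "card (line r d n) \<le> Suc n"
    using card_inj_on_le[OF inj sub] by simp
qed

text \<open>The tree lies inside the segment and has at least as many cells, so an upper bound on
  the size of the segment is enough.\<close>

lemma tree_line: "tree r v P \<Longrightarrow> (\<And>x. x \<noteq> d \<Longrightarrow> v x = 0) \<Longrightarrow> P = line r d (v d)"
proof -
  assume P: "tree r v P" and v: "\<And>x. x \<noteq> d \<Longrightarrow> v x = 0"
  have "P \<subseteq> line r d (v d)"
  proof
    fix p assume "p \<in> P"
    from tree_box[OF P this] v show "p \<in> line r d (v d)"
      by (auto simp: line_def) (metis add.right_neutral of_nat_0 order_antisym)
  qed
  moreover have "weight v = v d"
    using v[of AI] v[of AJ] v[of AL] by (cases d) (simp_all add: weight_eq)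
  then have "card (line r d (v d)) \<le> card P" using tree_card[OF P] card_line(2)[of r d "v d"] by simp
  ultimately show ?thesis using card_line(1) by (metis card_seteq)
qed

lemma trees_line:
  assumes "\<And>x. x \<noteq> d \<Longrightarrow> v x = 0"
  shows "trees r v = {line r d (v d)}"
  using tree_exists[of r v] tree_line[of r v _ d] assms by auto

lemma line_tree: "tree r ((\<lambda>_. 0)(d := n)) (line r d n)"
  using trees_line[of d "(\<lambda>_. 0)(d := n)" r] by auto

text \<open>Two nonempty disjoint groups among three axes include a group of one axis, so one branch
  is a segment and the other has extents \<open>v(d := 0)\<close>.\<close>

lemma joins_eq:
  "joins r v = (\<Union>d\<in>{d. v d > 0 \<and> (\<exists>e. e \<noteq> d \<and> v e > 0)}. (\<union>) (line r d (v d)) ` trees r (v(d := 0)))"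
    (is "_ = ?U")
proof
  have half: "Q \<union> R \<in> ?U"
    if t: "tree r u Q" "tree r w R" and disj: "\<And>x. u x = 0 \<or> w x = 0"
      and w: "w y > 0" and v: "v = (\<lambda>x. u x + w x)"
      and d: "u d > 0" "\<And>x. x \<noteq> d \<Longrightarrow> u x = 0" for u w Q R y d
  proof -
    have "w d = 0" using disj[of d] d(1) by simp
    have "Q = line r d (u d)" using tree_line[OF t(1)] d(2) by blast
    moreover have "v d = u d" using \<open>w d = 0\<close> by (simp add: v)
    moreover have "w = v(d := 0)" using \<open>w d = 0\<close> d(2) by (auto simp: v)
    moreover have "y \<noteq> d" "v y > 0" using w \<open>w d = 0\<close> by (auto simp: v)
    ultimately have "v d > 0 \<and> (\<exists>e. e \<noteq> d \<and> v e > 0)"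
      "Q \<union> R \<in> (\<union>) (line r d (v d)) ` trees r (v(d := 0))"
      using t(2) d(1) by auto
    then show ?thesis by blast
  qed
  show "joins r v \<subseteq> ?U"
  proof
    fix P assume "P \<in> joins r v"
    then obtain u w Q R x y where t: "tree r u Q" "tree r w R" and disj: "\<And>x. u x = 0 \<or> w x = 0"
      and u: "u x > 0" and w: "w y > 0" and v: "v = (\<lambda>x. u x + w x)" and P: "P = Q \<union> R"
      unfolding joins_def by blast
    have "(\<exists>d. u d > 0 \<and> (\<forall>x. x \<noteq> d \<longrightarrow> u x = 0)) \<or> (\<exists>d. w d > 0 \<and> (\<forall>x. x \<noteq> d \<longrightarrow> w x = 0))"
      using disj[of AI] disj[of AJ] disj[of AL] u w
      unfolding all_axis ex_axis by (cases x; cases y) auto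
    then show "P \<in> ?U"
    proof
      assume "\<exists>d. u d > 0 \<and> (\<forall>x. x \<noteq> d \<longrightarrow> u x = 0)"
      then show ?thesis using half[OF t disj w v] P by blast
    next
      assume "\<exists>d. w d > 0 \<and> (\<forall>x. x \<noteq> d \<longrightarrow> w x = 0)"
      moreover have "v = (\<lambda>x. w x + u x)" by (simp add: v add.commute)
      moreover have "w x = 0 \<or> u x = 0" for x using disj[of x] by auto
      ultimately show ?thesis using half[OF t(2,1) _ u] P by (metis Un_commute)
    qed
  qed
  show "?U \<subseteq> joins r v"
  proof
    fix P assume "P \<in> ?U"
    then obtain d e Q where d: "v d > 0" "e \<noteq> d" "v e > 0" and Q: "tree r (v(d := 0)) Q"
      and P: "P = line r d (v d) \<union> Q"
      by blast
    show "P \<in> joins r v"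
      unfolding joins_def mem_Collect_eq
    proof (intro exI conjI)
      show "P = line r d (v d) \<union> Q" by (rule P)
      show "tree r ((\<lambda>_. 0)(d := v d)) (line r d (v d))" by (rule line_tree)
      show "tree r (v(d := 0)) Q" by (rule Q)
      show "\<forall>x. ((\<lambda>_. 0)(d := v d)) x = 0 \<or> (v(d := 0)) x = 0" by simp
      show "((\<lambda>_. 0)(d := v d)) d > 0" using d by simp
      show "(v(d := 0)) e > 0" using d by simp
      show "v = (\<lambda>x. ((\<lambda>_. 0)(d := v d)) x + (v(d := 0)) x)" by auto
    qed
  qed
qed

section \<open>Counting trees\<close>

lemma card_trees_line:
  assumes "\<And>x. x \<noteq> d \<Longrightarrow> v x = 0"
  shows "card (trees r v) = 1"
  using trees_line[of d v r] assms by simp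

text \<open>Adding one turns the recurrence \<open>N(m, n) = N(m - 1, n) + N(m, n - 1) + 1\<close>
  into Pascal's rule with boundary value 2. The extra 1 is the only genuine join, two segments
  meeting at \<open>r\<close>.\<close>

lemma card_trees_plane:
  assumes "d \<noteq> e" "\<And>x. x \<noteq> d \<Longrightarrow> x \<noteq> e \<Longrightarrow> v x = 0"
  shows "card (trees r v) + 1 = 2 * ((v d + v e) choose v d)"
  using assms(2)
proof (induction "v d + v e" arbitrary: r v rule: less_induct)
  case less
  consider "v d = 0" | "v e = 0" | m n where "v d = Suc m" "v e = Suc n"
    by (meson not0_implies_Suc)
  then show ?case
  proof cases
    case 1
    then have "v x = 0" if "x \<noteq> e" for x using that less.prems[of x] by (cases "x = d") auto
    then show ?thesis using card_trees_line[of e v r] 1 by simp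
  next
    case 2
    then have "v x = 0" if "x \<noteq> d" for x using that less.prems[of x] by (cases "x = e") auto
    then show ?thesis using card_trees_line[of d v r] 2 by simp
  next
    case 3
    have pos: "{x. v x > 0} = {d, e}" using 3 less.prems by force
    have D: "card (trees (step r d) (v(d := v d - 1))) + 1 = 2 * ((m + Suc n) choose m)"
      using less.hyps[of "v(d := v d - 1)" "step r d"] less.prems 3 assms(1) by simp
    have E: "card (trees (step r e) (v(e := v e - 1))) + 1 = 2 * ((Suc m + n) choose Suc m)"
      using less.hyps[of "v(e := v e - 1)" "step r e"] less.prems 3 assms(1) by simp
    have "{x. v x > 0 \<and> (\<exists>y. y \<noteq> x \<and> v y > 0)} = {d, e}"
      using pos assms(1) by auto
    moreover have "trees r (v(d := 0)) = {line r e (v e)}"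
      using trees_line[of e "v(d := 0)" r] less.prems assms(1) by auto
    moreover have "trees r (v(e := 0)) = {line r d (v d)}"
      using trees_line[of d "v(e := 0)" r] less.prems assms(1) by auto
    ultimately have "joins r v = {line r d (v d) \<union> line r e (v e)}"
      unfolding joins_eq by auto
    then have J: "card (joins r v) = 1" by simp
    have "v \<noteq> (\<lambda>_. 0)" using 3(1) by auto
    from card_trees_decomp[OF this, of r] D E J assms(1) show ?thesis
      unfolding pos using 3 by simp
  qed
qed

text \<open>The tree \<open>Q\<close> lies in the plane through \<open>r\<close> orthogonal to
  \<open>d\<close>, which meets the segment only in \<open>r\<close>; so the union determines
  \<open>Q\<close>.\<close>

lemma line_Un_tree_inj:
  assumes "tree r (v(d := 0)) Q"
  shows "{p \<in> line r d n \<union> Q. coord p d = coord r d} = Q"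
proof -
  have "coord p d = coord r d" if "p \<in> Q" for p
    using tree_box[OF assms that, of d] by simp
  moreover have "p = r" if "p \<in> line r d n" "coord p d = coord r d" for p
  proof (rule cell_eqI)
    fix x show "coord p x = coord r x" using that by (cases "x = d") (simp_all add: line_def)
  qed
  ultimately show ?thesis using tree_root[OF assms] by blast
qed

definition tripod :: "cell \<Rightarrow> (axis \<Rightarrow> nat) \<Rightarrow> cell set" where
  "tripod r v = (\<Union>x. line r x (v x))"

lemma third_axis:
  assumes "d \<noteq> (e :: axis)"
  obtains f where "UNIV = {d, e, f}" "f \<noteq> d" "f \<noteq> e"
  using assms UNIV_axis by (cases d; cases e) auto

lemma tripod_in_lines: "tripod r v \<in> (\<union>) (line r d (v d)) ` trees r (v(d := 0))"
proof -
  obtain e where "e \<noteq> d" by (cases d) auto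
  then obtain f where f: "UNIV = {d, e, f}" "f \<noteq> d" "f \<noteq> e"
    using third_axis[of d e] by metis
  have "tree r (\<lambda>x. ((\<lambda>_. 0)(e := v e)) x + ((\<lambda>_. 0)(f := v f)) x) (line r e (v e) \<union> line r f (v f))"
    using f by (intro tree.join line_tree) auto
  moreover have "(\<lambda>x. ((\<lambda>_. 0)(e := v e)) x + ((\<lambda>_. 0)(f := v f)) x) = v(d := 0)"
  proof
    fix x have "x \<in> {d, e, f}" using f by blast
    then show "((\<lambda>_. 0)(e := v e)) x + ((\<lambda>_. 0)(f := v f)) x = (v(d := 0)) x"
      using f(2,3) \<open>e \<noteq> d\<close> by auto
  qed
  ultimately have "line r e (v e) \<union> line r f (v f) \<in> trees r (v(d := 0))" by simp
  moreover have "tripod r v = line r d (v d) \<union> (line r e (v e) \<union> line r f (v f))"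
    unfolding tripod_def f(1) by blast
  ultimately show ?thesis by blast
qed

text \<open>Of two branches using disjoint sets of directions one is a straight line. The trees
  with a straight branch along \<open>d\<close> and those with one along \<open>e \<noteq> d\<close> share only the tripod.\<close>

lemma card_joins_space:
  assumes pos: "\<And>x. v x > 0"
  shows "card (joins r v) + 2 = (\<Sum>d\<in>UNIV. card (trees r (v(d := 0))))"
proof -
  define L where "L d = (\<union>) (line r d (v d)) ` trees r (v(d := 0))" for d
  have "\<exists>e. e \<noteq> d" for d :: axis by (cases d) auto
  then have J: "joins r v = (\<Union>d. L d)" using pos unfolding joins_eq L_def by simp
  have t: "tripod r v \<in> L d" for d
    unfolding L_def by (rule tripod_in_lines)
  have cardL: "card (L d) = card (trees r (v(d := 0)))" for d
    unfolding L_def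
  proof (rule card_image, rule inj_onI)
    fix Q R
    assume "Q \<in> trees r (v(d := 0))" "R \<in> trees r (v(d := 0))"
      and eq: "line r d (v d) \<union> Q = line r d (v d) \<union> R"
    then have Q: "tree r (v(d := 0)) Q" and R: "tree r (v(d := 0)) R" by simp_all
    show "Q = R"
      using line_Un_tree_inj[OF Q, of "v d"] line_Un_tree_inj[OF R, of "v d"] eq by simp
  qed
  have finL: "finite (L d)" for d
    unfolding L_def by (intro finite_imageI finite_trees)
  have disj: "P = tripod r v" if PL: "P \<in> L d" "P \<in> L e" and de: "d \<noteq> e" for P d e
  proof -
    obtain f where f: "UNIV = {d, e, f}" "f \<noteq> d" "f \<noteq> e" using third_axis[OF de] .
    from PL obtain Q R where Q: "tree r (v(d := 0)) Q" "P = line r d (v d) \<union> Q"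
      and R: "tree r (v(e := 0)) R" "P = line r e (v e) \<union> R"
      unfolding L_def by blast
    \<comment> \<open>Trees with the same extents have the same number of cells, so inclusion will
      already give equality.\<close>
    have "P \<subseteq> tripod r v"
    proof
      fix p assume p: "p \<in> P"
      consider "p \<in> line r d (v d)" | "p \<in> line r e (v e)" | "p \<in> Q" "p \<in> R"
        using p Q(2) R(2) by blast
      then show "p \<in> tripod r v"
      proof cases
        case 3
        \<comment> \<open>Lying in both complementary trees pins the coordinates along
          \<open>d\<close> and \<open>e\<close>, leaving only the third axis.\<close>
        have "coord p d = coord r d" using tree_box[OF Q(1) 3(1), of d] by simp
        moreover have "coord p e = coord r e" using tree_box[OF R(1) 3(2), of e] by simp
        moreover have "x = d \<or> x = e" if "x \<noteq> f" for x using f(1) that by blast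
        ultimately have "p \<in> line r f (v f)"
          using tree_box[OF Q(1) 3(1), of f] f(2) unfolding line_def by auto
        then show ?thesis by (auto simp: tripod_def)
      qed (auto simp: tripod_def)
    qed
    moreover have "P \<in> joins r v" "tripod r v \<in> joins r v" using PL t J by blast+
    then have "tree r v P" "tree r v (tripod r v)" using joins_subset by blast+
    ultimately show ?thesis by (intro card_subset_eq) (simp_all add: tree_finite tree_card)
  qed
  \<comment> \<open>Away from the tripod the three families are disjoint, so the tripod is counted
    once instead of three times; this accounts for the 2.\<close>
  have "joins r v = insert (tripod r v) (\<Union>d. L d - {tripod r v})"
    unfolding J using t by blast
  then have "card (joins r v) = Suc (card (\<Union>d. L d - {tripod r v}))"
    using finL by (subst card.insert[symmetric]) auto
  also have "card (\<Union>d. L d - {tripod r v}) = (\<Sum>d\<in>UNIV. card (L d - {tripod r v}))"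
    using disj finL by (intro card_UN_disjoint) auto
  also have "\<dots> = (\<Sum>d\<in>UNIV. card (L d) - 1)"
    using t by simp
  finally have "card (joins r v) = Suc (\<Sum>d\<in>UNIV. card (L d) - 1)" .
  moreover have "card (L d) > 0" for d
    using t[of d] finL[of d] by (auto simp: card_gt_0_iff)
  then have "(\<Sum>d\<in>UNIV. card (L d)) = (\<Sum>d\<in>UNIV. (card (L d) - 1) + 1)"
    by (intro sum.cong) auto
  then have "(\<Sum>d\<in>UNIV. card (L d)) = (\<Sum>d\<in>UNIV. card (L d) - 1) + card (UNIV :: axis set)"
    by (simp only: sum.distrib sum_constant) simp
  moreover have "card (UNIV :: axis set) = 3" by (simp add: UNIV_axis)
  ultimately show ?thesis by (simp add: cardL)
qed

section \<open>The closed formula\<close>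

text \<open>At \<open>m = 0\<close> the rule reads 1 = 1 + 0, thanks to the value 0 at negative
  lower index.\<close>

lemma binom_pascal: "binom n m = binom (n - 1) m + binom (n - 1) (m - 1)"
proof -
  consider "m < 0" | "m = 0" | k where "m = int (Suc k)"
    by (metis gr0_implies_Suc linorder_less_linear zero_less_imp_eq_int)
  then show ?thesis
  proof cases
    case 3
    have "nat (int (Suc k)) = Suc k" "nat (int (Suc k) - 1) = k" by simp_all
    then show ?thesis
      using gbinomial_Suc_Suc[of "real_of_int (n - 1)" k] by (simp add: binom_def 3)
  qed (simp_all add: binom_def)
qed

lemma binom_neg [simp]: "m < 0 \<Longrightarrow> binom n m = 0"
  by (simp add: binom_def)

lemma binom_0 [simp]: "binom n 0 = 1"
  by (simp add: binom_def)

lemma binom_nat: "binom (int n) (int m) = real (n choose m)"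
  by (simp add: binom_def binomial_gbinomial)

lemma binom_eq_0: "0 \<le> n \<Longrightarrow> n < m \<Longrightarrow> binom n m = 0"
  using binom_nat[of "nat n" "nat m"] by simp

lemma binom_minus_1: "binom (- 1) (int m) = (- 1) ^ m"
  by (simp add: binom_def gbinomial_minus binomial_gbinomial[symmetric])

text \<open>The sum of the theorem in terms of extents. Integer arguments let the recurrence step
  outside the counting range, to \<open>b = - 1\<close>.\<close>

definition altsum :: "int \<Rightarrow> int \<Rightarrow> nat \<Rightarrow> real" where
  "altsum a b c = (\<Sum>i<c. (- 1) ^ i * binom (a + int c - 2 - 2 * int i) (int c - 1 - int i)
     * binom (a + b + int c - 1 - int i) (a + int c - 1 - 2 * int i))"

lemma altsum_rec: "altsum a b (Suc c) = altsum (a - 1) b (Suc c) + altsum a (b - 1) (Suc c) + altsum a b c"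
proof -
  define T where "T a b c i = (- 1) ^ i * binom (a + c - 2 - 2 * int i) (c - 1 - int i)
     * binom (a + b + c - 1 - int i) (a + c - 1 - 2 * int i)" for a b c i
  have T: "altsum a b c = (\<Sum>i<c. T a b (int c) i)" for a b c
    by (simp add: altsum_def T_def)
  \<comment> \<open>Pascal's rule in both factors, with \<open>A * N1\<close> left unexpanded so
    that only three products appear: the terms at \<open>a - 1\<close>, \<open>b - 1\<close> and
    \<open>c - 1\<close>, in this order.\<close>
  have distrib: "s * A * N = s * B * N2 + s * A * N1 + s * C * N2"
    if "A = B + C" "N = N1 + N2" for s A B C N N1 N2 :: real
    by (simp add: that algebra_simps)
  have "T a b c i = T (a - 1) b c i + T a (b - 1) c i + T a b (c - 1) i" for c i
    using distrib[OF binom_pascal[of "a + c - 2 - 2 * int i" "c - 1 - int i"]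
      binom_pascal[of "a + b + c - 1 - int i" "a + c - 1 - 2 * int i"], of "(- 1) ^ i"]
    by (simp add: T_def algebra_simps)
  from this[of "int (Suc c)"] have "altsum a b (Suc c) =
      (\<Sum>i<Suc c. T (a - 1) b (int (Suc c)) i + T a (b - 1) (int (Suc c)) i + T a b (int c) i)"
    unfolding T by (intro sum.cong refl) simp
  \<comment> \<open>The added term \<open>i = c\<close> has lower index \<open>- 1\<close> in its
    first factor and vanishes.\<close>
  moreover have "altsum a b c = (\<Sum>i<Suc c. T a b (int c) i)"
    by (simp add: T) (simp add: T_def)
  ultimately show ?thesis by (simp only: T sum.distrib)
qed

text \<open>Pascal's rule at \<open>b = 0\<close> leads to \<open>b = - 1\<close>, where the sum is again one with \<open>b = 0\<close>;
  this closes the induction that evaluates \<open>altsum a 0 c\<close>.\<close>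

lemma altsum_minus_1:
  assumes "a + int c \<ge> 1"
  shows "altsum a (- 1) (Suc c) = - altsum (a - 1) 0 c"
proof -
  \<comment> \<open>This is the second factor of the term \<open>i = 0\<close>. Shifting the index
    in the other terms flips the sign and lowers \<open>a\<close>.\<close>
  have "binom (a + int c - 1) (a + int c) = 0"
    using assms by (intro binom_eq_0) auto
  then show ?thesis
    unfolding altsum_def sum.lessThan_Suc_shift
    by (simp add: sum_negf[symmetric] algebra_simps)
qed

lemma altsum_empty [simp]: "altsum a b 0 = 0"
  by (simp add: altsum_def)

text \<open>Only a middle term can survive. Beyond it the second factor has negative lower index;
  before it the lower index of the first factor exceeds its nonnegative upper index; at it
  \<open>binom (- 1) i\<close> cancels the sign.\<close>

lemma altsum_left_0: "altsum 0 b c = of_bool (odd c)"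
proof -
  have *: "(- 1) ^ i * binom (0 + int c - 2 - 2 * int i) (int c - 1 - int i)
     * binom (0 + b + int c - 1 - int i) (0 + int c - 1 - 2 * int i) = of_bool (c = 2 * i + 1)"
    if "i < c" for i
  proof -
    consider "int c - 1 - 2 * int i < 0" | "int c - 1 - 2 * int i = 0" | "int c - 2 - 2 * int i \<ge> 0"
      by linarith
    then show ?thesis
    proof cases
      case 2
      then have c: "c = 2 * i + 1" by linarith
      have "(- 1 :: real) ^ i * (- 1) ^ i = 1" by (simp add: power_add[symmetric] mult_2[symmetric])
      then show ?thesis using binom_minus_1[of i] by (simp add: c)
    next
      case 3
      then have "binom (int c - 2 - 2 * int i) (int c - 1 - int i) = 0"
        by (intro binom_eq_0) auto
      then show ?thesis using 3 by auto
    qed auto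
  qed
  have "altsum 0 b c = (\<Sum>i<c. of_bool (c = 2 * i + 1))"
    unfolding altsum_def by (intro sum.cong refl, rule *) simp
  also have "\<dots> = of_bool (odd c)"
  proof (cases "odd c")
    case True
    then obtain j where "c = 2 * j + 1" by (elim oddE)
    then show ?thesis by (simp add: of_bool_def sum.delta)
  qed auto
  finally show ?thesis .
qed

lemma altsum_0_middle: "altsum (int a) 0 c = of_bool (odd c)"
proof (induction "a + c" arbitrary: a c rule: less_induct)
  case less
  consider "a = 0" | "c = 0" | a' c' where "a = Suc a'" "c = Suc c'"
    by (meson not0_implies_Suc)
  then show ?case
  proof cases
    case 3
    have "altsum (int a) 0 c = altsum (int a') 0 (Suc c') + altsum (int a) (- 1) (Suc c') + altsum (int a) 0 c'"
      using altsum_rec[of "int a" 0 c'] 3 by simp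
    also have "altsum (int a) (- 1) (Suc c') = - altsum (int a') 0 c'"
      using altsum_minus_1[of "int a" c'] 3 by simp
    \<comment> \<open>By induction the values at \<open>(a, c')\<close> and \<open>(a', c')\<close>
      coincide and cancel, leaving the value at \<open>(a', c)\<close>.\<close>
    finally show ?thesis
      using less[of a' "Suc c'"] less[of a c'] less[of a' c'] 3 by simp
  qed (simp_all add: altsum_left_0)
qed

section \<open>The closed formula in terms of extents and its recurrence\<close>

definition corner_count :: "nat \<Rightarrow> nat \<Rightarrow> nat \<Rightarrow> real" where
  "corner_count a b c = 4 * (real ((a + c) choose c) * real ((a + b + c) choose (a + c)))
     + altsum (int a) (int b) c
     - 2 * (real ((a + c) choose a) + real ((a + b) choose b) + real ((b + c) choose c))
     + 3 - of_bool (odd c)"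

text \<open>On the faces \<open>altsum\<close> equals the parity term that the formula subtracts, so
  the two cancel and the planar count of \<open>card_trees_plane\<close> remains.\<close>

lemma corner_count_0:
  "corner_count 0 b c = 2 * real ((b + c) choose c) - 1"
  "corner_count a 0 c = 2 * real ((a + c) choose c) - 1"
  "corner_count a b 0 = 2 * real ((a + b) choose b) - 1"
  using altsum_0_middle[of a c] binomial_symmetric[of a "a + b"] binomial_symmetric[of a "a + c"]
  by (simp_all add: corner_count_def altsum_left_0)

lemma binomial_add_Suc:
  "(Suc m + Suc n) choose Suc m = ((m + Suc n) choose m) + ((Suc m + n) choose Suc m)"
  "(Suc m + Suc n) choose Suc n = ((m + Suc n) choose Suc n) + ((Suc m + n) choose n)"
  by simp_all

text \<open>The product is a trinomial coefficient, counting lattice paths with given numbers of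
  steps in three directions; the summands sort the paths by their last step.\<close>

lemma trinomial_Suc:
  "real ((Suc a + Suc c) choose Suc c) * real ((Suc a + Suc b + Suc c) choose (Suc a + Suc c)) =
     real ((a + Suc c) choose Suc c) * real ((a + Suc b + Suc c) choose (a + Suc c))
   + real ((Suc a + Suc c) choose Suc c) * real ((Suc a + b + Suc c) choose (Suc a + Suc c))
   + real ((Suc a + c) choose c) * real ((Suc a + Suc b + c) choose (Suc a + c))"
proof -
  have distrib: "C * Z = A * X + C * Y + B * X" if "C = A + B" "Z = X + Y" for A B C X Y Z :: real
    by (simp add: that algebra_simps)
  have e1: "real ((Suc a + Suc c) choose Suc c) = real ((a + Suc c) choose Suc c) + real ((Suc a + c) choose c)"
    by simp
  have e2: "real ((Suc a + Suc b + Suc c) choose (Suc a + Suc c)) =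
      real ((a + Suc b + Suc c) choose (a + Suc c)) + real ((Suc a + b + Suc c) choose (Suc a + Suc c))"
    by simp
  have e3: "real ((Suc a + Suc b + c) choose (Suc a + c)) = real ((a + Suc b + Suc c) choose (a + Suc c))"
    by simp
  show ?thesis
    unfolding e3 by (rule distrib[OF e1 e2])
qed

text \<open>Each planar binomial arises twice from the three predecessors, once as it stands and
  once from its two Pascal parents, hence the correction by 2. The constants match by
  \<open>9 - 1 - 5 = 3\<close>, where 1 comes from the opposite parities of \<open>c\<close> and
  \<open>Suc c\<close>.\<close>

lemma corner_count_Suc:
  "corner_count (Suc a) (Suc b) (Suc c) =
     corner_count a (Suc b) (Suc c) + corner_count (Suc a) b (Suc c) + corner_count (Suc a) (Suc b) c
     + 2 * (real ((Suc a + Suc c) choose Suc a) + real ((Suc a + Suc b) choose Suc b)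
       + real ((Suc b + Suc c) choose Suc c)) - 5"
proof -
  have "altsum (int (Suc a)) (int (Suc b)) (Suc c) = altsum (int a) (int (Suc b)) (Suc c)
      + altsum (int (Suc a)) (int b) (Suc c) + altsum (int (Suc a)) (int (Suc b)) c"
    using altsum_rec[of "int (Suc a)" "int (Suc b)" c] by (simp only: of_nat_Suc add_diff_cancel_left')
  moreover have "of_bool (odd (Suc c)) = 1 - (of_bool (odd c) :: real)"
    by (cases "even c") simp_all
  ultimately show ?thesis
    unfolding corner_count_def trinomial_Suc of_nat_add
      binomial_add_Suc(1)[of a c] binomial_add_Suc(2)[of a b] binomial_add_Suc(2)[of b c]
    by (simp only: algebra_simps)
qed

text \<open>Both sides have the planar values on the faces. In the interior the decomposition at the
  root matches \<open>corner_count_Suc\<close>, whose 5 is the 2 of \<open>card_joins_space\<close>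
  plus a 1 from each of the three planar counts.\<close>

lemma card_trees: "real (card (trees r v)) = corner_count (v AI) (v AJ) (v AL)"
proof (induction "weight v" arbitrary: r v rule: less_induct)
  case less
  have plane: "real (card (trees r u)) = 2 * real ((u d + u e) choose u e) - 1"
    if "d \<noteq> e" "f \<noteq> d" "f \<noteq> e" "u f = 0" for u d e f
  proof -
    have "u x = 0" if "x \<noteq> d" "x \<noteq> e" for x
      using that \<open>u f = 0\<close> \<open>d \<noteq> e\<close> \<open>f \<noteq> d\<close> \<open>f \<noteq> e\<close> by (cases x; cases d; cases e; cases f) auto
    with card_trees_plane[of e d u r] \<open>d \<noteq> e\<close>
    have "card (trees r u) + 1 = 2 * ((u d + u e) choose u e)" by (simp add: add.commute)
    then have "real (card (trees r u) + 1) = real (2 * ((u d + u e) choose u e))" by (rule arg_cong)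
    then show ?thesis by simp
  qed
  show ?case
  proof (cases "\<exists>x. v x = 0")
    case True
    then consider "v AI = 0" | "v AJ = 0" | "v AL = 0" unfolding ex_axis by metis
    then show ?thesis
    proof cases
      case 1
      then show ?thesis using plane[of AJ AL AI v] by (simp add: corner_count_0(1))
    next
      case 2
      then show ?thesis using plane[of AI AL AJ v] by (simp add: corner_count_0(2))
    next
      case 3
      then show ?thesis using plane[of AI AJ AL v] by (simp add: corner_count_0(3))
    qed
  next
    case False
    then have pos: "v x > 0" for x by auto
    obtain a where a: "v AI = Suc a" using pos gr0_implies_Suc by blast
    obtain b where b: "v AJ = Suc b" using pos gr0_implies_Suc by blast
    obtain c where c: "v AL = Suc c" using pos gr0_implies_Suc by blast
    have IH: "real (card (trees (step r d) (v(d := v d - 1)))) =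
        corner_count ((v(d := v d - 1)) AI) ((v(d := v d - 1)) AJ) ((v(d := v d - 1)) AL)" for d
      using weight_upd[of v d "v d - 1"] pos[of d] by (intro less) linarith
    have sum: "(\<Sum>d\<in>UNIV. f d) = f AI + f AJ + f AL" for f :: "axis \<Rightarrow> nat"
      by (simp add: UNIV_axis)
    have "v \<noteq> (\<lambda>_. 0)" using a by auto
    moreover have "{x. v x > 0} = UNIV" using pos by blast
    ultimately have "card (trees r v) + 2 =
        (\<Sum>d\<in>UNIV. card (trees (step r d) (v(d := v d - 1)))) + (\<Sum>d\<in>UNIV. card (trees r (v(d := 0))))"
      using card_trees_decomp[of v r] card_joins_space[of v r] pos by simp
    then have "real (card (trees r v)) + 2 =
        (real (card (trees (step r AI) (v(AI := v AI - 1)))) + real (card (trees (step r AJ) (v(AJ := v AJ - 1))))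
          + real (card (trees (step r AL) (v(AL := v AL - 1)))))
        + (real (card (trees r (v(AI := 0)))) + real (card (trees r (v(AJ := 0))))
          + real (card (trees r (v(AL := 0)))))"
      unfolding sum by linarith
    also have "\<dots> = (corner_count a (Suc b) (Suc c) + corner_count (Suc a) b (Suc c) + corner_count (Suc a) (Suc b) c)
        + (2 * real ((Suc b + Suc c) choose Suc c) - 1 + (2 * real ((Suc a + Suc c) choose Suc c) - 1)
          + (2 * real ((Suc a + Suc b) choose Suc b) - 1))"
      using plane[of AJ AL AI "v(AI := 0)"] plane[of AI AL AJ "v(AJ := 0)"] plane[of AI AJ AL "v(AL := 0)"]
      unfolding IH by (simp add: a b c del: binomial_Suc_Suc)
    also have "((Suc a + Suc c) choose Suc c) = ((Suc a + Suc c) choose Suc a)"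
      using binomial_symmetric[of "Suc c" "Suc a + Suc c"] by (simp del: binomial_Suc_Suc)
    finally show ?thesis
      unfolding a b c corner_count_Suc by (simp del: binomial_Suc_Suc add_Suc add_Suc_right)
  qed
qed

theorem theorem2:
  fixes b k h :: nat
  assumes "b \<ge> 1" and "k \<ge> 1" and "h \<ge> 1"
  shows "real (p_c b k h) =
      4 * binom (int b + int h - 2) (int h - 1)
        * binom (int b + int k + int h - 3) (int b + int h - 2)
    + (\<Sum>i<h - 1. (- 1) ^ i
        * binom (int b + int h - 4 - 2 * int i) (int h - 2 - int i)
        * binom (int b + int k + int h - 4 - int i) (int b + int h - 3 - 2 * int i))
    - 2 * (binom (int b + int h - 2) (int b - 1)
         + binom (int b + int k - 2) (int k - 1)
         + binom (int k + int h - 2) (int h - 1))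
    + 3 - (1 + (- 1) ^ h) / 2"
proof -
  obtain a e c where s: "b = Suc a" "k = Suc e" "h = Suc c"
    using assms by (metis not0_implies_Suc not_one_le_zero)
  have args: "int b + int h - 2 = int (a + c)" "int b + int k + int h - 3 = int (a + e + c)"
    "int b + int k - 2 = int (a + e)" "int k + int h - 2 = int (e + c)"
    "int b - 1 = int a" "int k - 1 = int e" "int h - 1 = int c" "h - 1 = c"
    by (simp_all add: s)
  have "altsum (int a) (int e) c = (\<Sum>i<c. (- 1) ^ i
      * binom (int b + int h - 4 - 2 * int i) (int h - 2 - int i)
      * binom (int b + int k + int h - 4 - int i) (int b + int h - 3 - 2 * int i))"
    unfolding altsum_def by (intro sum.cong refl arg_cong2[of _ _ _ _ binom] arg_cong2[of _ _ _ _ "(*)"]) (simp_all add: s)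
  \<comment> \<open>With \<open>h = Suc c\<close>, the theorem's indicator of even \<open>h\<close>
    is the indicator of odd \<open>c\<close>.\<close>
  moreover have "of_bool (odd c) = (1 + (- 1 :: real) ^ h) / 2"
    by (cases "even c") (simp_all add: s)
  moreover have "real (p_c b k h) = corner_count a e c"
    unfolding p_c_def corner_polyomino_iff[OF assms] card_trees by (simp add: s)
  ultimately show ?thesis
    unfolding args binom_nat corner_count_def mult.assoc[of 4] by linarith
qed

end
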